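(* Let $k\in\mathbb{N}$, let $H_k\in\mathbb{R}^{l\times l}$ be positive definite, let $G_k\in\mathbb{R}^{q\times l}$ have rank $l$, and let $f_k\in\mathbb{R}^l$, $e_k\in\mathbb{R}^q$. For an invertible matrix $R_k\in\mathbb{R}^{l\times l}$ and a vector $r_k\in\mathbb{R}^l$ define the transformed parameters $$\tilde H_k:=R_k^\top H_kR_k,\quad \tilde G_k:=G_kR_k,\quad \tilde f_k:=R_k^\top(f_k+H_kr_k),\quad \tilde e_k:=e_k-G_kr_k.$$ Then, for any choice of invertible $R_k$ and any choice of $r_k$, $$\tilde G_k\tilde H_k^{-1}\tilde G_k^\top=G_kH_k^{-1}G_k^\top\qquad\text{and}\qquad \tilde G_k\tilde H_k^{-1}\tilde f_k+\tilde e_k=G_kH_k^{-1}f_k+e_k.$$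
   Context: The parameters $H_k,G_k,f_k,e_k$ define the quadratic program $\min_z \frac12 z^\top H_kz+f_k^\top z$ subject to $G_kz\le e_k$, with constant dimensions $l,q\in\mathbb{N}$. The transformed parameters arise from the substitution $z=R_ky+r_k$. *)

theory Defs
  imports "HOL-Analysis.Analysis"
begin

(* Symmetry is not part of this definition: a symmetric positive definite matrix in the
   narrower sense satisfies it, so results assuming positive_definite cover both conventions. *)
definition positive_definite :: "real^'n^'n \<Rightarrow> bool" where
  "positive_definite A \<longleftrightarrow> (\<forall>x. x \<noteq> 0 \<longrightarrow> x \<bullet> (A *v x) > 0)"

(* Parameters of the quadratic program  min 1/2 z^T H z + f^T z  s.t.  G z \<le> e  after the
   substitution z = R y + r. The rows of G range over 'q, its columns over 'l. *)

definition transformed_H :: "real^'l^'l \<Rightarrow> real^'l^'l \<Rightarrow> real^'l^'l" where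
  "transformed_H H R = transpose R ** H ** R"

definition transformed_G :: "real^'l^'q \<Rightarrow> real^'l^'l \<Rightarrow> real^'l^'q" where
  "transformed_G G R = G ** R"

definition transformed_f ::
  "real^'l^'l \<Rightarrow> real^'l \<Rightarrow> real^'l^'l \<Rightarrow> real^'l \<Rightarrow> real^'l" where
  "transformed_f H f R r = transpose R *v (f + H *v r)"

definition transformed_e :: "real^'l^'q \<Rightarrow> real^'q \<Rightarrow> real^'l \<Rightarrow> real^'q" where
  "transformed_e G e r = e - G *v r"

end

theory Submission
  imports Defs
begin

text \<open>Since \<open>H\<close> and \<open>R\<close> are invertible, the inverse of R^T H R is
  R^-1 H^-1 R^-T. Hence (G R)(R^T H R)^-1 R^T collapses to G H^-1, which is
  \<open>transformed_G_times_inverse_H\<close>. Both the transpose of G R and the transformed linear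
  term begin with the factor R^T, so this single cancellation gives both equations; in the second,
  the shift \<open>r\<close> adds G r on one side and is removed by the transformed right-hand side
  e - G r.\<close>

lemma positive_definite_invertible:
  fixes A :: "real^'n^'n"
  assumes "positive_definite A"
  shows "invertible A"
proof -
  \<comment> \<open>A nonzero kernel vector would give x \<bullet> (A x) = 0, contrary to
    positivity. For a square matrix a trivial kernel already yields an inverse.\<close>
  have "x = 0" if "A *v x = 0" for x
    using assms that unfolding positive_definite_def by force
  then show ?thesis
    using invertible_left_inverse matrix_left_invertible_ker by blast
qed

text \<open>\<open>matrix_inv\<close> chooses some two-sided inverse; invertibility guarantees that
  the choice has a witness.\<close>

lemma matrix_inv_right_left:
  fixes A :: "'a::semiring_1^'n^'m"
  assumes "invertible A"
  shows matrix_inv_right: "A ** matrix_inv A = mat 1"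
    and matrix_inv_left: "matrix_inv A ** A = mat 1"
  using someI_ex[OF assms[unfolded invertible_def]] by (simp_all add: matrix_inv_def)

lemma matrix_inv_unique:
  fixes A :: "'a::semiring_1^'n^'m"
  assumes "A ** B = mat 1" "B ** A = mat 1"
  shows "matrix_inv A = B"
proof -
  have "invertible A"
    using assms by (auto simp: invertible_def)
  then have "matrix_inv A = matrix_inv A ** A ** B"
    using assms(1) by (simp add: matrix_mul_assoc[symmetric])
  then show ?thesis
    using \<open>invertible A\<close> by (simp add: matrix_inv_left)
qed

lemma matrix_inv_mult:
  fixes A B :: "'a::semiring_1^'n^'n"
  assumes "invertible A" "invertible B"
  shows "matrix_inv (A ** B) = matrix_inv B ** matrix_inv A"
proof (rule matrix_inv_unique)
  have "A ** B ** (matrix_inv B ** matrix_inv A) = A ** (B ** matrix_inv B) ** matrix_inv A"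
    by (simp only: matrix_mul_assoc)
  then show "A ** B ** (matrix_inv B ** matrix_inv A) = mat 1"
    using assms by (simp add: matrix_inv_right)
  have "matrix_inv B ** matrix_inv A ** (A ** B) = matrix_inv B ** (matrix_inv A ** A) ** B"
    by (simp only: matrix_mul_assoc)
  then show "matrix_inv B ** matrix_inv A ** (A ** B) = mat 1"
    using assms by (simp add: matrix_inv_left)
qed

text \<open>The trailing \<open>transpose R\<close> is kept so that it cancels the R^-T from the
  inverse of R^T H R, just as \<open>R\<close> cancels R^-1 on the left.\<close>

lemma transformed_G_times_inverse_H:
  assumes "invertible H" "invertible R"
  shows "transformed_G G R ** matrix_inv (transformed_H H R) ** transpose R
    = G ** matrix_inv H"
proof -
  have RT: "invertible (transpose R)"
    using assms(2) by (rule transpose_invertible)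
  have "transformed_G G R ** matrix_inv (transformed_H H R) ** transpose R
    = G ** (R ** matrix_inv R) ** matrix_inv H ** (matrix_inv (transpose R) ** transpose R)"
    using assms RT by (simp add: transformed_G_def transformed_H_def matrix_inv_mult
        invertible_mult matrix_mul_assoc)
  also have "\<dots> = G ** matrix_inv H"
    using assms RT by (simp add: matrix_inv_left matrix_inv_right)
  finally show ?thesis .
qed

theorem lemma1:
  fixes k :: nat
    and H :: "nat \<Rightarrow> real^'l^'l"
    and G :: "nat \<Rightarrow> real^'l^'q"
    and f :: "nat \<Rightarrow> real^'l"
    and e :: "nat \<Rightarrow> real^'q"
    and R :: "nat \<Rightarrow> real^'l^'l"
    and r :: "nat \<Rightarrow> real^'l"
  assumes "positive_definite (H k)"
    and "rank (G k) = CARD('l)"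
    and "invertible (R k)"
  shows "transformed_G (G k) (R k) ** matrix_inv (transformed_H (H k) (R k))
             ** transpose (transformed_G (G k) (R k))
           = G k ** matrix_inv (H k) ** transpose (G k)
         \<and> (transformed_G (G k) (R k) ** matrix_inv (transformed_H (H k) (R k)))
             *v transformed_f (H k) (f k) (R k) (r k)
             + transformed_e (G k) (e k) (r k)
           = (G k ** matrix_inv (H k)) *v f k + e k"
proof -
  let ?M = "transformed_G (G k) (R k) ** matrix_inv (transformed_H (H k) (R k))"
  have H: "invertible (H k)"
    using assms(1) by (rule positive_definite_invertible)
  note M = transformed_G_times_inverse_H[OF H assms(3), of "G k"]
  have "?M ** transpose (transformed_G (G k) (R k)) = ?M ** transpose (R k) ** transpose (G k)"
    by (simp add: transformed_G_def matrix_transpose_mul matrix_mul_assoc)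
  moreover have "?M *v transformed_f (H k) (f k) (R k) (r k)
      = (?M ** transpose (R k)) *v (f k + H k *v r k)"
    by (simp only: transformed_f_def matrix_vector_mul_assoc)
  \<comment> \<open>The contribution of the shift to the linear term, which cancels against the -G r
    in \<open>transformed_e\<close>.\<close>
  moreover have "(G k ** matrix_inv (H k)) *v (H k *v r k) = G k *v r k"
    using H by (simp add: matrix_vector_mul_assoc matrix_mul_assoc[symmetric] matrix_inv_left)
  ultimately show ?thesis
    by (simp add: M transformed_e_def matrix_vector_right_distrib)
qed

end
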